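(* For every $n\in\mathbb{N}$, $$\sum_{k=0}^{2n}(-1)^kW_{k+1}\star\tilde{G}_{2n-k}=(-1)^n[2]_q^{2n}y(xxyy)^n=\sum_{k=0}^{2n}(-1)^k\tilde{G}_{2n-k}\star W_{k+1},$$ $$q\sum_{k=0}^{2n+1}(-1)^kW_{k+1}\star\tilde{G}_{2n+1-k}=(-1)^n[2]_q^{2n+1}xyy(xxyy)^n=q^{-1}\sum_{k=0}^{2n+1}(-1)^k\tilde{G}_{2n+1-k}\star W_{k+1}.$$
   Context: Let $\mathbb{F}$ be a field of characteristic zero and let $q\in\mathbb{F}$ be nonzero and not a root of unity; $\mathbb{N}=\{0,1,2,\ldots\}$; $[2]_q=q+q^{-1}$. Let $\mathbb{V}$ be the free associative unital $\mathbb{F}$-algebra on two noncommuting generators (letters) $x,y$; the words in $x,y$ (including the trivial word $\mathbf{1}$) form a basis of $\mathbb{V}$. Words such as $(xxyy)^nx$ are written with respect to the free (concatenation) product. The $q$-shuffle product $\star$ on the vector space $\mathbb{V}$ is the bilinear associative product with unit $\mathbf{1}$ determined as follows. Put $\langle x,x\rangle=\langle y,y\rangle=2$ and $\langle x,y\rangle=\langle y,x\rangle=-2$. For nontrivial words $u=u_1\cdots u_r$ and $v=v_1\cdots v_s$, $$u\star v=u_1\big((u_2\cdots u_r)\star v\big)+v_1\big(u\star(v_2\cdots v_s)\big)q^{\langle v_1,u_1\rangle+\cdots+\langle v_1,u_r\rangle}.$$ The alternating words are, for $n\in\mathbb{N}$ (powers in the free product): $\tilde{G}_{n+1}=(xy)^{n+1}$,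 $G_{n+1}=(yx)^{n+1}$, $W_{-n}=(xy)^nx$, $W_{n+1}=(yx)^ny$; also $G_0=\tilde{G}_0=\mathbf{1}$. *)

theory Defs
  imports Complex_Main "HOL-Library.Poly_Mapping"
begin

datatype letter = X | Y

text \<open>
  Words form the free monoid under concatenation, written additively so that
  \<open>Poly_Mapping\<close> supplies the convolution product. Thus on \<open>letter list \<Rightarrow>\<^sub>0 'a\<close>
  the operation \<open>*\<close> is the free product, \<open>1\<close> is the trivial word, and \<open>^\<close> is the power with
  respect to the free product.
\<close>

instantiation list :: (type) monoid_add
begin

definition zero_list :: "'a list" where "zero_list = []"

definition plus_list :: "'a list \<Rightarrow> 'a list \<Rightarrow> 'a list" where "plus_list u v = u @ v"

instance by intro_classes (simp_all add: zero_list_def plus_list_def)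

end

type_synonym 'a word_algebra = "letter list \<Rightarrow>\<^sub>0 'a"

definition word :: "letter list \<Rightarrow> 'a::field word_algebra" where
  "word w = Poly_Mapping.single w 1"

abbreviation gen_x :: "'a::field word_algebra" (\<open>\<^bold>x\<close>) where "\<^bold>x \<equiv> word [X]"

abbreviation gen_y :: "'a::field word_algebra" (\<open>\<^bold>y\<close>) where "\<^bold>y \<equiv> word [Y]"

definition wscale :: "'a::field \<Rightarrow> 'a word_algebra \<Rightarrow> 'a word_algebra" (infixr \<open>*\<^sub>V\<close> 75) where
  "c *\<^sub>V f = Poly_Mapping.map ((*) c) f"

definition pairing :: "letter \<Rightarrow> letter \<Rightarrow> int" where
  "pairing a b = (if a = b then 2 else -2)"

fun word_qshuffle :: "'a::field \<Rightarrow> letter list \<Rightarrow> letter list \<Rightarrow> 'a word_algebra" where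
  "word_qshuffle q [] v = word v"
| "word_qshuffle q (a # u) [] = word (a # u)"
| "word_qshuffle q (a # u) (b # v) =
     word [a] * word_qshuffle q u (b # v)
     + (q powi (\<Sum>c\<leftarrow>a # u. pairing b c)) *\<^sub>V (word [b] * word_qshuffle q (a # u) v)"

definition qshuffle ::
  "'a::field word_algebra \<Rightarrow> 'a \<Rightarrow> 'a word_algebra \<Rightarrow> 'a word_algebra"
  (\<open>(_ \<star>\<^bsub>_\<^esub> _)\<close> [71, 0, 70] 70) where
  "f \<star>\<^bsub>q\<^esub> g =
     (\<Sum>u\<in>Poly_Mapping.keys f. \<Sum>v\<in>Poly_Mapping.keys g.
        (Poly_Mapping.lookup f u * Poly_Mapping.lookup g v) *\<^sub>V word_qshuffle q u v)"

definition Gt :: "nat \<Rightarrow> 'a::field word_algebra" where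
  "Gt n = (\<^bold>x * \<^bold>y) ^ n"

text \<open>Indexed by the integers: \<open>W (- n) = (xy)\<^sup>nx\<close> and \<open>W (n + 1) = (yx)\<^sup>ny\<close> for natural \<open>n\<close>.\<close>

definition W :: "int \<Rightarrow> 'a::field word_algebra" where
  "W k = (if k \<le> 0 then (\<^bold>x * \<^bold>y) ^ nat (- k) * \<^bold>x else (\<^bold>y * \<^bold>x) ^ nat (k - 1) * \<^bold>y)"

definition q2 :: "'a::field \<Rightarrow> 'a" (\<open>[2]\<^bsub>_\<^esub>\<close>) where
  "[2]\<^bsub>q\<^esub> = q + inverse q"

lemma word_Nil: "word [] = 1"
  by (simp add: word_def zero_list_def [symmetric])

lemma word_append: "word (u @ v) = word u * word v"
  by (simp add: word_def mult_single plus_list_def)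

lemma lookup_wscale [simp]:
  "Poly_Mapping.lookup (c *\<^sub>V f) w = c * Poly_Mapping.lookup f w"
  by (simp add: wscale_def Poly_Mapping.map.rep_eq when_def)

interpretation word_algebra: vector_space "(*\<^sub>V) :: 'a::field \<Rightarrow> _"
  by unfold_locales (auto intro!: poly_mapping_eqI simp: lookup_add algebra_simps)

lemma qshuffle_word: "word u \<star>\<^bsub>q\<^esub> word v = word_qshuffle q u v"
  by (simp add: qshuffle_def word_def)

lemma qshuffle_expand:
  assumes "finite A" "finite B" "Poly_Mapping.keys f \<subseteq> A" "Poly_Mapping.keys g \<subseteq> B"
  shows "f \<star>\<^bsub>q\<^esub> g =
     (\<Sum>u\<in>A. \<Sum>v\<in>B.
        (Poly_Mapping.lookup f u * Poly_Mapping.lookup g v) *\<^sub>V word_qshuffle q u v)"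
proof -
  have "(\<Sum>v\<in>Poly_Mapping.keys g. (c * Poly_Mapping.lookup g v) *\<^sub>V word_qshuffle q u v) =
      (\<Sum>v\<in>B. (c * Poly_Mapping.lookup g v) *\<^sub>V word_qshuffle q u v)" for u c
    by (rule sum.mono_neutral_left) (use assms in \<open>auto simp: in_keys_iff\<close>)
  then have "f \<star>\<^bsub>q\<^esub> g = (\<Sum>u\<in>Poly_Mapping.keys f. \<Sum>v\<in>B.
        (Poly_Mapping.lookup f u * Poly_Mapping.lookup g v) *\<^sub>V word_qshuffle q u v)"
    by (simp add: qshuffle_def)
  also have "\<dots> = (\<Sum>u\<in>A. \<Sum>v\<in>B.
        (Poly_Mapping.lookup f u * Poly_Mapping.lookup g v) *\<^sub>V word_qshuffle q u v)"
    by (rule sum.mono_neutral_left) (use assms in \<open>auto simp: in_keys_iff\<close>)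
  finally show ?thesis .
qed

lemma qshuffle_add_left: "(f + g) \<star>\<^bsub>q\<^esub> h = f \<star>\<^bsub>q\<^esub> h + g \<star>\<^bsub>q\<^esub> h"
proof -
  let ?A = "Poly_Mapping.keys f \<union> Poly_Mapping.keys g" and ?B = "Poly_Mapping.keys h"
  have "Poly_Mapping.keys (f + g) \<subseteq> ?A" by (rule keys_add)
  then show ?thesis
    by (simp add: qshuffle_expand [of ?A ?B] lookup_add distrib_right
        word_algebra.scale_left_distrib sum.distrib)
qed

lemma qshuffle_add_right: "f \<star>\<^bsub>q\<^esub> (g + h) = f \<star>\<^bsub>q\<^esub> g + f \<star>\<^bsub>q\<^esub> h"
proof -
  let ?A = "Poly_Mapping.keys f" and ?B = "Poly_Mapping.keys g \<union> Poly_Mapping.keys h"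
  have "Poly_Mapping.keys (g + h) \<subseteq> ?B" by (rule keys_add)
  then show ?thesis
    by (simp add: qshuffle_expand [of ?A ?B] lookup_add distrib_left
        word_algebra.scale_left_distrib sum.distrib)
qed

lemma qshuffle_scale_left: "(c *\<^sub>V f) \<star>\<^bsub>q\<^esub> g = c *\<^sub>V (f \<star>\<^bsub>q\<^esub> g)"
proof -
  let ?A = "Poly_Mapping.keys f" and ?B = "Poly_Mapping.keys g"
  have "Poly_Mapping.keys (c *\<^sub>V f) \<subseteq> ?A" by (auto simp: in_keys_iff)
  then show ?thesis
    by (simp add: qshuffle_expand [of ?A ?B] word_algebra.scale_sum_right mult.assoc)
qed

lemma qshuffle_scale_right: "f \<star>\<^bsub>q\<^esub> (c *\<^sub>V g) = c *\<^sub>V (f \<star>\<^bsub>q\<^esub> g)"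
proof -
  let ?A = "Poly_Mapping.keys f" and ?B = "Poly_Mapping.keys g"
  have "Poly_Mapping.keys (c *\<^sub>V g) \<subseteq> ?B" by (auto simp: in_keys_iff)
  then show ?thesis
    by (simp add: qshuffle_expand [of ?A ?B] word_algebra.scale_sum_right mult.left_commute)
qed

lemma qshuffle_unit_left: "1 \<star>\<^bsub>q\<^esub> word w = word w"
  by (simp add: qshuffle_word flip: word_Nil)

lemma qshuffle_unit_right: "word w \<star>\<^bsub>q\<^esub> 1 = word w"
  by (cases w) (simp_all add: qshuffle_word flip: word_Nil)

lemma qshuffle_rec:
  "word (a # u) \<star>\<^bsub>q\<^esub> word (b # v) =
     word [a] * (word u \<star>\<^bsub>q\<^esub> word (b # v))
     + (q powi (\<Sum>c\<leftarrow>a # u. pairing b c)) *\<^sub>V (word [b] * (word (a # u) \<star>\<^bsub>q\<^esub> word v))"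
  by (simp add: qshuffle_word)

end

theory Submission
  imports Defs
begin

text \<open>
  Removing the first letter of an alternating word leaves an alternating word. Hence the signed
  convolutions \<open>\<Sum>k\<le>m. (-1)\<^sup>k f k \<star> g (m - k)\<close>, named \<open>A m\<close>, \<open>B m\<close>, \<open>S m\<close>, \<open>T m\<close> for the pairs
  \<open>(Gt, Gt)\<close>, \<open>(Wpos, Wpos)\<close>, \<open>(Wpos, Gt)\<close>, \<open>(Gt, Wpos)\<close> with \<open>Wpos k = W (k + 1)\<close>, form a closed
  system under the recursion of the \<open>q\<close>-shuffle product:
  \<open>S (m+1) = y A (m+1) + q\<^sup>-\<^sup>2 x B m\<close>, \<open>T (m+1) = y A (m+1) - x B m\<close>,
  \<open>A (m+1) = x (T m - S m)\<close> and \<open>B m = y (T m + q\<^sup>2 S m)\<close>. If \<open>S m = T m\<close> then \<open>A (m+1) = 0\<close>, and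
  if \<open>T m = - q\<^sup>2 S m\<close> then \<open>B m = 0\<close>; the two cases alternate with the parity of \<open>m\<close>, and
  every step contributes a factor \<open>[2]\<^sub>q\<close>. Reversing the order of summation in \<open>T m\<close> costs the
  sign \<open>(-1)\<^sup>m\<close>.
\<close>

text \<open>Scaling is multiplication by a multiple of the empty word, which commutes with every
  word.\<close>

lemma word_mult_wscale: "word w * (c *\<^sub>V f) = c *\<^sub>V (word w * f)"
proof -
  have conv: "c *\<^sub>V g = Poly_Mapping.single 0 c * g" for g :: "'a::field word_algebra"
    unfolding wscale_def by (rule mult_map_scale_conv_mult)
  have "word w * Poly_Mapping.single 0 c = Poly_Mapping.single 0 c * word w"
    by (simp add: word_def mult_single)
  then show ?thesis
    by (simp add: conv mult.assoc [symmetric])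
qed

text \<open>An explicit letter list, because \<open>word_qshuffle\<close> recurses on
  letters.\<close>

definition Gt_letters :: "nat \<Rightarrow> letter list" where
  "Gt_letters n = concat (replicate n [X, Y])"

abbreviation Wpos :: "nat \<Rightarrow> 'a::field word_algebra" where
  "Wpos n \<equiv> W (int n + 1)"

lemma Gt_letters_0: "Gt_letters 0 = []"
  and Gt_letters_Suc: "Gt_letters (Suc n) = X # Y # Gt_letters n"
  by (simp_all add: Gt_letters_def)

lemma Gt_eq_word: "(Gt n :: 'a::field word_algebra) = word (Gt_letters n)"
proof (induction n)
  case 0
  show ?case by (simp add: Gt_def Gt_letters_0 word_Nil)
next
  case (Suc n)
  then have "(Gt (Suc n) :: 'a word_algebra) = \<^bold>x * \<^bold>y * word (Gt_letters n)"
    by (simp add: Gt_def)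
  then show ?case by (simp add: Gt_letters_Suc word_append [symmetric])
qed

text \<open>Regrouping (yx)^n y as y(xy)^n exposes the first letter and leaves \<open>Gt n\<close>
  behind it.\<close>

lemma Wpos_eq_word: "(Wpos n :: 'a::field word_algebra) = word (Y # Gt_letters n)"
proof -
  have comm: "(\<^bold>y * \<^bold>x) ^ n * \<^bold>y = (\<^bold>y * (\<^bold>x * \<^bold>y) ^ n :: 'a word_algebra)"
    by (induction n) (simp_all add: mult.assoc)
  have "(Wpos n :: 'a word_algebra) = \<^bold>y * Gt n"
    using comm by (simp add: W_def Gt_def)
  then show ?thesis
    by (simp add: Gt_eq_word word_append [symmetric])
qed

text \<open>The letters x and y occur equally often, so their pairings with \<open>b\<close> cancel.
  In the recursion a left factor \<open>Gt\<close> thus gives exponent 0, and \<open>Wpos\<close>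
  only the pairing with its surplus y.\<close>

lemma Gt_letters_pairing: "(\<Sum>c\<leftarrow>Gt_letters n. pairing b c) = 0"
  by (induction n; cases b) (simp_all add: Gt_letters_0 Gt_letters_Suc pairing_def)

lemma word_qshuffle_Nil_right: "word_qshuffle q u [] = word u"
  by (cases u) simp_all

lemmas alternating_simps =
  Gt_eq_word Wpos_eq_word Gt_letters_0 Gt_letters_Suc qshuffle_word Gt_letters_pairing
  word_qshuffle_Nil_right word_append [symmetric]

lemma
  shows Wpos_Gt_0: "Wpos k \<star>\<^bsub>q\<^esub> Gt 0 = \<^bold>y * (Gt k \<star>\<^bsub>q\<^esub> Gt 0)"
    and Gt_0_Wpos: "Gt 0 \<star>\<^bsub>q\<^esub> Wpos k = \<^bold>y * (Gt 0 \<star>\<^bsub>q\<^esub> Gt k)"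
    and Gt_Suc_Gt_0: "Gt (Suc k) \<star>\<^bsub>q\<^esub> Gt 0 = \<^bold>x * (Wpos k \<star>\<^bsub>q\<^esub> Gt 0)"
    and Gt_0_Gt_Suc: "Gt 0 \<star>\<^bsub>q\<^esub> Gt (Suc k) = \<^bold>x * (Gt 0 \<star>\<^bsub>q\<^esub> Wpos k)"
  by (simp_all add: alternating_simps)

lemma Wpos_Gt_Suc:
  "Wpos k \<star>\<^bsub>q\<^esub> Gt (Suc j) =
     \<^bold>y * (Gt k \<star>\<^bsub>q\<^esub> Gt (Suc j)) + (q powi (-2)) *\<^sub>V (\<^bold>x * (Wpos k \<star>\<^bsub>q\<^esub> Wpos j))"
  by (simp add: alternating_simps pairing_def)

lemma Gt_Suc_Wpos:
  "Gt (Suc i) \<star>\<^bsub>q\<^esub> Wpos k = \<^bold>x * (Wpos i \<star>\<^bsub>q\<^esub> Wpos k) + \<^bold>y * (Gt (Suc i) \<star>\<^bsub>q\<^esub> Gt k)"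
  by (simp add: alternating_simps pairing_def)

lemma Gt_Suc_Gt_Suc:
  "Gt (Suc i) \<star>\<^bsub>q\<^esub> Gt (Suc j) =
     \<^bold>x * (Wpos i \<star>\<^bsub>q\<^esub> Gt (Suc j)) + \<^bold>x * (Gt (Suc i) \<star>\<^bsub>q\<^esub> Wpos j)"
  by (simp add: alternating_simps pairing_def)

lemma Wpos_Wpos:
  "Wpos i \<star>\<^bsub>q\<^esub> Wpos j = \<^bold>y * (Gt i \<star>\<^bsub>q\<^esub> Wpos j) + q\<^sup>2 *\<^sub>V (\<^bold>y * (Wpos i \<star>\<^bsub>q\<^esub> Gt j))"
  by (simp add: alternating_simps pairing_def)

definition signed_conv ::
  "'a::field \<Rightarrow> (nat \<Rightarrow> 'a word_algebra) \<Rightarrow> (nat \<Rightarrow> 'a word_algebra) \<Rightarrow> nat \<Rightarrow> 'a word_algebra" where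
  "signed_conv q f g m = (\<Sum>k=0..m. (-1) ^ k *\<^sub>V (f k \<star>\<^bsub>q\<^esub> g (m - k)))"

lemma signed_conv_rev:
  "(\<Sum>k=0..m. (-1) ^ k *\<^sub>V (f (m - k) \<star>\<^bsub>q\<^esub> g k)) = (-1) ^ m *\<^sub>V signed_conv q f g m"
proof -
  have sign: "(-1) ^ (m - k) = ((-1) ^ m * (-1) ^ k :: 'a)" if "k \<le> m" for k
    using that by (simp add: minus_one_power_iff)
  have "(\<Sum>k=0..m. (-1) ^ k *\<^sub>V (f (m - k) \<star>\<^bsub>q\<^esub> g k)) =
      (\<Sum>k=0..m. (-1) ^ (m - k) *\<^sub>V (f k \<star>\<^bsub>q\<^esub> g (m - k)))"
    by (subst sum.atLeastAtMost_rev) (auto intro!: sum.cong)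
  also have "\<dots> = (-1) ^ m *\<^sub>V signed_conv q f g m"
    unfolding signed_conv_def word_algebra.scale_sum_right
    by (rule sum.cong) (simp_all add: sign)
  finally show ?thesis .
qed

text \<open>Once the term with \<open>g 0\<close> is split off, every right factor has a successor
  index, as the recursion rules require.\<close>

lemma signed_conv_last:
  "signed_conv q f g (Suc m) =
     (\<Sum>k=0..m. (-1) ^ k *\<^sub>V (f k \<star>\<^bsub>q\<^esub> g (Suc (m - k)))) + (-1) ^ Suc m *\<^sub>V (f (Suc m) \<star>\<^bsub>q\<^esub> g 0)"
  by (simp add: signed_conv_def Suc_diff_le)

lemma signed_conv_first:
  "signed_conv q f g (Suc m) =
     f 0 \<star>\<^bsub>q\<^esub> g (Suc m) - (\<Sum>k=0..m. (-1) ^ k *\<^sub>V (f (Suc k) \<star>\<^bsub>q\<^esub> g (m - k)))"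
  unfolding signed_conv_def
  by (subst sum.atLeast0_atMost_Suc_shift) (simp add: sum_negf)

lemmas signed_conv_distribs =
  sum.distrib word_algebra.scale_right_distrib sum_distrib_left word_mult_wscale
  word_algebra.scale_sum_right distrib_left mult.assoc mult.commute

text \<open>The split-off term with \<open>Gt 0\<close> has a y part only, so the x parts run
  exactly over the convolution at \<open>m\<close>.\<close>

lemma signed_conv_Wpos_Gt_Suc:
  "signed_conv q Wpos Gt (Suc m) =
     \<^bold>y * signed_conv q Gt Gt (Suc m) + (q powi (-2)) *\<^sub>V (\<^bold>x * signed_conv q Wpos Wpos m)"
  unfolding signed_conv_last Wpos_Gt_Suc Wpos_Gt_0 signed_conv_def [of _ Wpos Wpos]
  by (simp add: signed_conv_distribs right_diff_distrib)

lemma signed_conv_Gt_Wpos_Suc: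
  "signed_conv q Gt Wpos (Suc m) =
     \<^bold>y * signed_conv q Gt Gt (Suc m) - \<^bold>x * signed_conv q Wpos Wpos m"
  unfolding signed_conv_first Gt_Suc_Wpos Gt_0_Wpos signed_conv_def [of _ Wpos Wpos]
  by (simp add: signed_conv_distribs right_diff_distrib)

text \<open>Both end terms are split off: \<open>Gt 0\<close> on the left feeds only T, on the right
  only S. Removing the first letter of the left factor lowers its index by one, hence the minus sign
  at S. For \<open>m = 0\<close> no inner terms exist.\<close>

lemma signed_conv_Gt_Gt_Suc:
  "signed_conv q Gt Gt (Suc m) =
     \<^bold>x * (signed_conv q Gt Wpos m - signed_conv q Wpos Gt m)"
proof (cases m)
  case 0
  then show ?thesis
    by (simp add: signed_conv_def Gt_0_Gt_Suc Gt_Suc_Gt_0 right_diff_distrib)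
next
  case (Suc p)
  have "signed_conv q Gt Gt (Suc (Suc p)) = Gt 0 \<star>\<^bsub>q\<^esub> Gt (Suc (Suc p))
      - ((\<Sum>k=0..p. (-1) ^ k *\<^sub>V (Gt (Suc k) \<star>\<^bsub>q\<^esub> Gt (Suc (p - k))))
      + (-1) ^ Suc p *\<^sub>V (Gt (Suc (Suc p)) \<star>\<^bsub>q\<^esub> Gt 0))"
    unfolding signed_conv_first by (simp add: Suc_diff_le)
  then show ?thesis
    unfolding Suc signed_conv_first [of _ Gt Wpos] signed_conv_last [of _ Wpos Gt]
      Gt_Suc_Gt_Suc Gt_0_Gt_Suc Gt_Suc_Gt_0
    by (simp add: signed_conv_distribs right_diff_distrib)
qed

text \<open>No boundary terms arise, since the words \<open>Wpos k\<close> are never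
  trivial.\<close>

lemma signed_conv_Wpos_Wpos:
  "signed_conv q Wpos Wpos m =
     \<^bold>y * (signed_conv q Gt Wpos m + q\<^sup>2 *\<^sub>V signed_conv q Wpos Gt m)"
  unfolding signed_conv_def Wpos_Wpos by (simp add: signed_conv_distribs)

lemma signed_conv_even_step:
  assumes "q \<noteq> 0" and "signed_conv q Wpos Gt m = f" and "signed_conv q Gt Wpos m = f"
  shows "q *\<^sub>V signed_conv q Wpos Gt (Suc m) = [2]\<^bsub>q\<^esub> *\<^sub>V (\<^bold>x * \<^bold>y * f)"
    and "- inverse q *\<^sub>V signed_conv q Gt Wpos (Suc m) = [2]\<^bsub>q\<^esub> *\<^sub>V (\<^bold>x * \<^bold>y * f)"
proof -
  have A: "signed_conv q Gt Gt (Suc m) = 0"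
    by (simp add: signed_conv_Gt_Gt_Suc assms)
  have B: "signed_conv q Wpos Wpos m = (1 + q\<^sup>2) *\<^sub>V (\<^bold>y * f)"
    by (simp add: signed_conv_Wpos_Wpos assms distrib_left word_mult_wscale
        word_algebra.scale_left_distrib)
  \<comment> \<open>Both identities amount to 1 + q^2 = q (q + q^-1).\<close>
  have coeff: "q * (q powi (-2) * (1 + q\<^sup>2)) = [2]\<^bsub>q\<^esub>" "inverse q * (1 + q\<^sup>2) = [2]\<^bsub>q\<^esub>"
    using assms(1) by (simp_all add: q2_def power_int_minus field_simps power2_eq_square)
  show "q *\<^sub>V signed_conv q Wpos Gt (Suc m) = [2]\<^bsub>q\<^esub> *\<^sub>V (\<^bold>x * \<^bold>y * f)"
    using coeff(1) by (simp add: signed_conv_Wpos_Gt_Suc A B word_mult_wscale mult.assoc)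
  show "- inverse q *\<^sub>V signed_conv q Gt Wpos (Suc m) = [2]\<^bsub>q\<^esub> *\<^sub>V (\<^bold>x * \<^bold>y * f)"
    using coeff(2) by (simp add: signed_conv_Gt_Wpos_Suc A B word_mult_wscale mult.assoc)
qed

lemma signed_conv_odd_step:
  assumes "q \<noteq> 0" and "q *\<^sub>V signed_conv q Wpos Gt m = f"
    and "- inverse q *\<^sub>V signed_conv q Gt Wpos m = f"
  shows "signed_conv q Wpos Gt (Suc m) = - [2]\<^bsub>q\<^esub> *\<^sub>V (\<^bold>y * \<^bold>x * f)"
    and "signed_conv q Gt Wpos (Suc m) = - [2]\<^bsub>q\<^esub> *\<^sub>V (\<^bold>y * \<^bold>x * f)"
proof -
  have S: "signed_conv q Wpos Gt m = inverse q *\<^sub>V f"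
    using assms(1) by (simp flip: assms(2))
  have T: "signed_conv q Gt Wpos m = - q *\<^sub>V f"
    using assms(1) by (simp flip: assms(3))
  \<comment> \<open>The difference T - S equals (-q - q^-1) f; this is the source of the alternating
    sign.\<close>
  have A: "signed_conv q Gt Gt (Suc m) = - [2]\<^bsub>q\<^esub> *\<^sub>V (\<^bold>x * f)"
    by (simp add: signed_conv_Gt_Gt_Suc S T q2_def right_diff_distrib word_mult_wscale
        word_algebra.scale_left_distrib word_algebra.scale_left_diff_distrib)
  have B: "signed_conv q Wpos Wpos m = 0"
    using assms(1) by (simp add: signed_conv_Wpos_Wpos S T power2_eq_square mult.assoc)
  show "signed_conv q Wpos Gt (Suc m) = - [2]\<^bsub>q\<^esub> *\<^sub>V (\<^bold>y * \<^bold>x * f)"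
    by (simp add: signed_conv_Wpos_Gt_Suc A B word_mult_wscale mult.assoc)
  show "signed_conv q Gt Wpos (Suc m) = - [2]\<^bsub>q\<^esub> *\<^sub>V (\<^bold>y * \<^bold>x * f)"
    by (simp add: signed_conv_Gt_Wpos_Suc A B word_mult_wscale mult.assoc)
qed

lemma signed_conv_even:
  fixes q :: "'a::field"
  assumes "q \<noteq> 0"
  defines "P \<equiv> \<lambda>n. ((-1) ^ n * [2]\<^bsub>q\<^esub> ^ (2*n)) *\<^sub>V (\<^bold>y * (\<^bold>x * \<^bold>x * \<^bold>y * \<^bold>y) ^ n)"
  shows "signed_conv q Wpos Gt (2*n) = P n \<and> signed_conv q Gt Wpos (2*n) = P n"
proof (induction n)
  case 0
  have "W 1 = (\<^bold>y :: 'a word_algebra)" "Gt 0 = (1 :: 'a word_algebra)"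
    by (simp_all add: W_def Gt_def)
  then show ?case
    by (simp add: signed_conv_def P_def qshuffle_unit_left qshuffle_unit_right)
next
  case (Suc n)
  \<comment> \<open>Two steps put yx and then xy before y(xxyy)^n: yx xy y regroups as y
    xxyy.\<close>
  have "P (Suc n) = - [2]\<^bsub>q\<^esub> *\<^sub>V (\<^bold>y * \<^bold>x * ([2]\<^bsub>q\<^esub> *\<^sub>V (\<^bold>x * \<^bold>y * P n)))"
    by (simp add: P_def word_mult_wscale mult.assoc)
  with signed_conv_odd_step [OF assms(1) signed_conv_even_step [OF assms(1)]] Suc
  show ?case by simp
qed

theorem proposition5p7:
  fixes q :: "'a::field_char_0" and n :: nat
  assumes "q \<noteq> 0"
    and "\<And>m::nat. m > 0 \<Longrightarrow> q ^ m \<noteq> 1"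
  shows "(\<Sum>k=0..2*n. (-1)^k *\<^sub>V (W (int k + 1) \<star>\<^bsub>q\<^esub> Gt (2*n - k)))
           = ((-1)^n * [2]\<^bsub>q\<^esub> ^ (2*n)) *\<^sub>V (\<^bold>y * (\<^bold>x * \<^bold>x * \<^bold>y * \<^bold>y) ^ n) \<and>
         ((-1)^n * [2]\<^bsub>q\<^esub> ^ (2*n)) *\<^sub>V (\<^bold>y * (\<^bold>x * \<^bold>x * \<^bold>y * \<^bold>y) ^ n)
           = (\<Sum>k=0..2*n. (-1)^k *\<^sub>V (Gt (2*n - k) \<star>\<^bsub>q\<^esub> W (int k + 1))) \<and>
         q *\<^sub>V (\<Sum>k=0..2*n+1. (-1)^k *\<^sub>V (W (int k + 1) \<star>\<^bsub>q\<^esub> Gt (2*n + 1 - k)))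
           = ((-1)^n * [2]\<^bsub>q\<^esub> ^ (2*n+1)) *\<^sub>V (\<^bold>x * \<^bold>y * \<^bold>y * (\<^bold>x * \<^bold>x * \<^bold>y * \<^bold>y) ^ n) \<and>
         ((-1)^n * [2]\<^bsub>q\<^esub> ^ (2*n+1)) *\<^sub>V (\<^bold>x * \<^bold>y * \<^bold>y * (\<^bold>x * \<^bold>x * \<^bold>y * \<^bold>y) ^ n)
           = inverse q *\<^sub>V (\<Sum>k=0..2*n+1. (-1)^k *\<^sub>V (Gt (2*n + 1 - k) \<star>\<^bsub>q\<^esub> W (int k + 1)))"
proof -
  note even = signed_conv_even [OF assms(1), of n]
  \<comment> \<open>One more step puts xy before y(xxyy)^n, which gives xyy(xxyy)^n.\<close>
  note odd = signed_conv_even_step [OF assms(1) even [THEN conjunct1] even [THEN conjunct2]]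
  \<comment> \<open>The reversal sign is -1 only for the odd length, where it absorbs the minus of
    \<open>- inverse q\<close>.\<close>
  have rev: "(\<Sum>k=0..2*n. (-1)^k *\<^sub>V (Gt (2*n - k) \<star>\<^bsub>q\<^esub> Wpos k)) = signed_conv q Gt Wpos (2*n)"
    "(\<Sum>k=0..2*n+1. (-1)^k *\<^sub>V (Gt (2*n + 1 - k) \<star>\<^bsub>q\<^esub> Wpos k))
       = - signed_conv q Gt Wpos (Suc (2*n))"
    using signed_conv_rev [where f = Gt and g = Wpos and m = "2*n"]
      signed_conv_rev [where f = Gt and g = Wpos and m = "2*n + 1"]
    by simp_all
  have conv: "(\<Sum>k=0..m. (-1)^k *\<^sub>V (Wpos k \<star>\<^bsub>q\<^esub> Gt (m - k))) = signed_conv q Wpos Gt m" for m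
    by (simp add: signed_conv_def)
  show ?thesis
    unfolding rev conv using even odd
    by (simp add: word_mult_wscale mult.assoc mult.left_commute [of "[2]\<^bsub>q\<^esub>"])
qed

end
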